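(* Assume that moves between pegs $0$ and $2$ are forbidden (i.e. $w_{n,1}=\infty$ for all $n\in\mathbb{N}_0$). Then the vectors $d_n=(d_{n,0},d_{n,1},d_{n,2})^{\mathrm t}$ of minimal costs satisfy, for all $n\in\mathbb{N}_0$, $$d_{n+1}=\mathbf{B}d_n+v_n,$$ where $$\mathbf{B}=\begin{pmatrix}0&1&1\\0&3&0\\1&1&0\end{pmatrix},\qquad v_n=(w_{n,0},\;w_{n,0}+w_{n,2},\;w_{n,2})^{\mathrm t}.$$
   Context: Weighted Tower of Hanoi with a forbidden move type: $\mathbb{N}_0$ denotes the nonnegative integers; $T=\{0,1,2\}$ is the set of pegs; discs are labelled $1,2,3,\dots$ by increasing size. A state with $n$ discs is an assignment of the discs $1,\dots,n$ to the pegs, the discs on each peg being stacked with smaller discs above larger ones. A move transfers the topmost (smallest) disc of one peg to a different peg carrying no smaller disc. For $i\in T$, $i^n$ is the perfect state with all $n$ discs on peg $i$. For $\{i,j,k\}=T$ and $n\in\mathbb{N}_0$, $w_{n,k}$ is the cost of a single move of disc $n+1$ between pegs $i$ and $j$ (in either direction); here $w_{n,0},w_{n,2}\in[0,\infty)$, while $w_{n,1}=\infty$ means that no direct move between pegs $0$ and $2$ is allowed. $d_{n,k}$ is the minimal total cost, over all finite sequences of allowed moves, of getting from $i^n$ to $j^n$ with $n$ discs, where $\{i,j,k\}=T$. *)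

theory Defs
  imports "HOL-Analysis.Analysis"
begin

text \<open>
  Pegs are the elements \<open>0, 1, 2\<close> of the three-element type \<open>3\<close>.
  Note that \<open>3 = 0\<close> holds in that type.
\<close>

type_synonym peg = 3
type_synonym state = "nat \<Rightarrow> peg"

text \<open>
  A state only records the peg of each disc, since the order of the discs on a peg is forced.
  States are extensional functions, so that equality of states is equality on the discs.
\<close>

definition states :: "nat \<Rightarrow> state set" where
  "states n = {1..n} \<rightarrow>\<^sub>E UNIV"

definition perfect :: "nat \<Rightarrow> peg \<Rightarrow> state" where
  "perfect n i = (\<lambda>m\<in>{1..n}. i)"

text \<open>
  In \<open>allowed_move w n s c t\<close> the disc \<open>Suc m\<close> is moved from peg \<open>i\<close> to peg \<open>j\<close> at cost
  \<open>c = w m k\<close>; infinite cost means that the move is forbidden.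
  The condition \<open>{i, j, k} = UNIV\<close> makes the three pegs distinct.
\<close>

definition allowed_move ::
    "(nat \<Rightarrow> peg \<Rightarrow> ennreal) \<Rightarrow> nat \<Rightarrow> state \<Rightarrow> ennreal \<Rightarrow> state \<Rightarrow> bool" where
  "allowed_move w n s c t \<longleftrightarrow> s \<in> states n \<and>
     (\<exists>m<n. \<exists>i j k. {i, j, k} = UNIV \<and> s (Suc m) = i \<and>
        (\<forall>l\<in>{1..m}. s l \<noteq> i \<and> s l \<noteq> j) \<and>
        t = s(Suc m := j) \<and> c = w m k \<and> c < \<infinity>)"

inductive move_sequence ::
    "(nat \<Rightarrow> peg \<Rightarrow> ennreal) \<Rightarrow> nat \<Rightarrow> state \<Rightarrow> ennreal \<Rightarrow> state \<Rightarrow> bool" for w n where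
  empty: "s \<in> states n \<Longrightarrow> move_sequence w n s 0 s"
| step: "move_sequence w n s c t \<Longrightarrow> allowed_move w n t c' u \<Longrightarrow> move_sequence w n s (c + c') u"

text \<open>
  The infimum below is a minimum as soon as there is any sequence of allowed moves, see
  \<open>min_cost_attained\<close>; otherwise it is \<open>\<infinity>\<close>.
\<close>

definition min_cost :: "(nat \<Rightarrow> peg \<Rightarrow> ennreal) \<Rightarrow> nat \<Rightarrow> peg \<Rightarrow> peg \<Rightarrow> ennreal" where
  "min_cost w n i j = Inf {c. move_sequence w n (perfect n i) c (perfect n j)}"

text \<open>
  The two pegs other than \<open>k\<close> are \<open>k + 1\<close> and \<open>k + 2\<close>, calculated modulo 3. Which of them is the
  source and which the target does not matter, see \<open>hanoi_cost_eq\<close>.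
\<close>

definition hanoi_cost :: "(nat \<Rightarrow> peg \<Rightarrow> ennreal) \<Rightarrow> nat \<Rightarrow> peg \<Rightarrow> ennreal" where
  "hanoi_cost w n k = min_cost w n (k + 1) (k + 2)"

text \<open>
  Components are listed in the order \<open>0, 1, 2\<close> of the pegs, whereas \<open>vector\<close> numbers them
  \<open>1, 2, 3\<close>.
\<close>

definition cost_vector :: "(nat \<Rightarrow> peg \<Rightarrow> ennreal) \<Rightarrow> nat \<Rightarrow> ennreal ^ 3" where
  "cost_vector w n = vector [hanoi_cost w n 0, hanoi_cost w n 1, hanoi_cost w n 2]"

lemma allowed_move_sym:
  assumes "allowed_move w n s c t"
  shows "allowed_move w n t c s"
proof -
  from assms obtain m i j k where s: "s \<in> states n" and m: "m < n" and ijk: "{i, j, k} = UNIV"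
    and i: "s (Suc m) = i" and l: "\<forall>l\<in>{1..m}. s l \<noteq> i \<and> s l \<noteq> j"
    and t: "t = s(Suc m := j)" and c: "c = w m k" "c < \<infinity>"
    unfolding allowed_move_def by blast
  have "t \<in> states n"
    using s m by (auto simp: t states_def PiE_iff extensional_def)
  moreover have "{j, i, k} = UNIV" using ijk by (simp add: insert_commute)
  moreover have "\<forall>l\<in>{1..m}. t l \<noteq> j \<and> t l \<noteq> i" "t (Suc m) = j" "s = t(Suc m := i)"
    using l i by (auto simp: t)
  ultimately show ?thesis
    unfolding allowed_move_def using m c by blast
qed

lemma move_sequence_trans:
  assumes "move_sequence w n t c' u" "move_sequence w n s c t"
  shows "move_sequence w n s (c + c') u"
  using assms
  by (induction) (auto simp: add.assoc[symmetric] intro: move_sequence.step)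

lemma move_sequence_sym:
  assumes "move_sequence w n s c t"
  shows "move_sequence w n t c s"
  using assms
proof (induction)
  case (empty s)
  then show ?case by (rule move_sequence.empty)
next
  case (step s c t c' u)
  have "u \<in> states n"
    using allowed_move_sym[OF step.hyps(2)] by (simp add: allowed_move_def)
  then have "move_sequence w n u (0 + c') t"
    using allowed_move_sym[OF step.hyps(2)] by (blast intro: move_sequence.intros)
  from move_sequence_trans[OF step.IH this] show ?case
    by (simp add: add.commute)
qed

lemma min_cost_sym: "min_cost w n i j = min_cost w n j i"
  unfolding min_cost_def using move_sequence_sym by (intro arg_cong[where f = Inf]) blast

lemma hanoi_cost_eq:
  assumes "{i, j, k} = (UNIV :: peg set)"
  shows "hanoi_cost w n k = min_cost w n i j"
proof -
  have "card {i, j, k} = 3" using assms by simp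
  then have "i \<noteq> j" "i \<noteq> k" "j \<noteq> k" by (auto simp: card_insert_if split: if_splits)
  then have "i = k + 1 \<and> j = k + 2 \<or> i = k + 2 \<and> j = k + 1"
    using exhaust_3[of i] exhaust_3[of j] exhaust_3[of k] by auto
  then show ?thesis unfolding hanoi_cost_def by (metis min_cost_sym)
qed

lemma min_cost_attained:
  assumes "move_sequence w n (perfect n i) x (perfect n j)"
  shows "move_sequence w n (perfect n i) (min_cost w n i j) (perfect n j)"
proof -
  define W where "W = case_prod w ` ({..<n} \<times> UNIV)"
  define \<epsilon> where "\<epsilon> = Min (insert 1 (W - {0}))"
  define S where "S = rec_nat {0} (\<lambda>_ A. A \<union> case_prod (+) ` (A \<times> W))"
  have W: "finite W" by (simp add: W_def)
  have \<epsilon>: "\<epsilon> > 0" "\<epsilon> < \<infinity>" and \<epsilon>_le: "a \<in> W \<Longrightarrow> a \<noteq> 0 \<Longrightarrow> \<epsilon> \<le> a" for a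
  proof -
    have "\<epsilon> \<in> insert 1 (W - {0})" unfolding \<epsilon>_def using W by (intro Min_in) auto
    then show "\<epsilon> > 0" by (auto simp: zero_less_iff_neq_zero)
    have "\<epsilon> \<le> 1" unfolding \<epsilon>_def using W by (intro Min_le) auto
    then show "\<epsilon> < \<infinity>" by (rule le_less_trans) simp
    show "a \<in> W \<Longrightarrow> a \<noteq> 0 \<Longrightarrow> \<epsilon> \<le> a" unfolding \<epsilon>_def using W by (intro Min_le) auto
  qed
  have finS: "finite (S N)" for N
    by (induction N) (auto simp: S_def W)
  have bound: "c < \<infinity> \<and> (\<exists>N. c \<in> S N \<and> of_nat N * \<epsilon> \<le> c)" if "move_sequence w n s c t" for s c t
    using that
  proof (induction)
    case (empty s)
    have "0 \<in> S 0" by (simp add: S_def)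
    then show ?case by (force intro: exI[of _ 0])
  next
    case (step s c t c' u)
    have c': "c' \<in> W" "c' < \<infinity>"
      using step.hyps(2) by (auto simp: allowed_move_def W_def)
    from step.IH obtain N where c: "c < \<infinity>" and N: "c \<in> S N" "of_nat N * \<epsilon> \<le> c" by blast
    have "\<exists>N. c + c' \<in> S N \<and> of_nat N * \<epsilon> \<le> c + c'"
    proof (cases "c' = 0")
      case True
      then show ?thesis using N by auto
    next
      case False
      have "c + c' \<in> S (Suc N)" using N(1) c'(1) by (force simp: S_def)
      moreover have "of_nat (Suc N) * \<epsilon> \<le> c + c'"
        using add_mono[OF N(2) \<epsilon>_le[OF c'(1) False]] by (simp add: distrib_right add.commute)
      ultimately show ?thesis by blast
    qed
    then show ?case using c c' by simp
  qed
  define C where "C = {c. move_sequence w n (perfect n i) c (perfect n j)}"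
  have xC: "x \<in> C" and "x < \<infinity>" using assms bound by (auto simp: C_def)
  have "\<exists>M. \<forall>N. of_nat N * \<epsilon> \<le> x \<longrightarrow> N \<le> M"
  proof -
    obtain e where e: "\<epsilon> = ennreal e" "0 < e"
      using \<epsilon> by (cases \<epsilon>) auto
    obtain y where y: "x = ennreal y" "0 \<le> y"
      using \<open>x < \<infinity>\<close> by (cases x) auto
    have "N \<le> nat \<lceil>y / e\<rceil>" if "of_nat N * \<epsilon> \<le> x" for N
    proof -
      have "ennreal (real N * e) \<le> ennreal y"
        using that e y by (simp add: ennreal_mult ennreal_of_nat_eq_real_of_nat)
      then have "real N \<le> y / e" using e y by (simp add: field_simps)
      then show ?thesis by linarith
    qed
    then show ?thesis by blast
  qed
  then obtain M where M: "of_nat N * \<epsilon> \<le> x \<Longrightarrow> N \<le> M" for N by blast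
  have "C \<inter> {..x} \<subseteq> (\<Union>N\<le>M. S N)"
  proof
    fix c assume c: "c \<in> C \<inter> {..x}"
    then have "move_sequence w n (perfect n i) c (perfect n j)" by (simp add: C_def)
    from bound[OF this] obtain N where "c \<in> S N" "of_nat N * \<epsilon> \<le> c" by blast
    then show "c \<in> (\<Union>N\<le>M. S N)" using c M[of N] by (auto intro: order_trans)
  qed
  then have fin: "finite (C \<inter> {..x})" using finS by (auto intro: finite_subset)
  define \<mu> where "\<mu> = Min (C \<inter> {..x})"
  have mem: "\<mu> \<in> C \<inter> {..x}" unfolding \<mu>_def using fin xC by (intro Min_in) auto
  have "\<mu> \<le> c" if "c \<in> C" for c
  proof (cases "c \<le> x")
    case True
    then show ?thesis unfolding \<mu>_def using fin that by (intro Min_le) auto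
  next
    case False
    then show ?thesis using mem by auto
  qed
  then have "Inf C = \<mu>" using mem by (intro antisym Inf_lower Inf_greatest) auto
  then show ?thesis using mem by (simp add: min_cost_def C_def)
qed

end

theory Submission
  imports Defs
begin

text \<open>
  Call the peg that takes part in every permitted move of the largest disc the hub \<open>h\<close> (peg \<open>1\<close>
  in the theorem) and the others the ends \<open>a\<close> and \<open>b\<close>. The largest disc can move between \<open>a\<close> and \<open>h\<close> only while all
  smaller discs are on \<open>b\<close>, and between \<open>h\<close> and \<open>b\<close> only while all smaller discs are on \<open>a\<close>.
  A largest disc that starts on \<open>a\<close> must walk along the path \<open>a\<close>, \<open>h\<close>, \<open>b\<close>, so the smaller discs
  are forced through the perfect states on \<open>b\<close> and then on \<open>a\<close>. Between these events they move as
  if the largest disc did not exist. Walking back and forth cannot help, since cancelling a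
  detour never increases the cost.

  The upper bounds (\<open>distance_end_hub_le\<close>, \<open>distance_end_end_le\<close>) concatenate optimal solutions for
  the smaller discs. The lower bounds come from a potential (\<open>potential_le_cost\<close>): for each position of
  the largest disc, the cost of reaching the present configuration along the direct walk is a lower
  bound for the cost of every sequence of moves leading there. This is preserved by each single move, so
  the sequences need not be cut into phases. It requires costs between arbitrary states,
  not only perfect ones.
\<close>

section \<open>The distance between two states\<close>

definition distance :: "(nat \<Rightarrow> peg \<Rightarrow> ennreal) \<Rightarrow> nat \<Rightarrow> state \<Rightarrow> state \<Rightarrow> ennreal" where
  "distance w n s t = Inf {c. move_sequence w n s c t}"

lemma min_cost_eq_distance: "min_cost w n i j = distance w n (perfect n i) (perfect n j)"
  by (simp add: min_cost_def distance_def)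

lemma distance_le: "move_sequence w n s c t \<Longrightarrow> distance w n s t \<le> c"
  by (auto simp: distance_def intro: Inf_lower)

lemma distance_refl: "s \<in> states n \<Longrightarrow> distance w n s s = 0"
  using distance_le[OF move_sequence.empty] by (metis le_zero_eq)

lemma distance_le_move: "allowed_move w n s c t \<Longrightarrow> distance w n s t \<le> c"
  using distance_le[OF move_sequence.step[OF move_sequence.empty]]
  by (fastforce simp: allowed_move_def)

text \<open>
  Nearly optimal sequences are concatenated; an arbitrary slack avoids a discussion of whether
  optimal ones exist.
\<close>

lemma distance_triangle: "distance w n s u \<le> distance w n s t + distance w n t u"
proof (rule ennreal_le_epsilon)
  fix e :: real
  assume "distance w n s t + distance w n t u < top" and e: "0 < e"
  then have fin: "distance w n s t < \<infinity>" "distance w n t u < \<infinity>"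
    by (auto simp: less_top)
  have near: "\<exists>c. move_sequence w n x c y \<and> c < distance w n x y + ennreal (e / 2)"
    if "distance w n x y < \<infinity>" for x y
  proof -
    have "distance w n x y < distance w n x y + ennreal (e / 2)"
      using that e by (cases "distance w n x y") (auto simp flip: ennreal_plus simp: ennreal_less_iff)
    then show ?thesis
      unfolding distance_def Inf_less_iff by auto
  qed
  obtain c c' where c: "move_sequence w n s c t" "c < distance w n s t + ennreal (e / 2)"
    and c': "move_sequence w n t c' u" "c' < distance w n t u + ennreal (e / 2)"
    using near fin by blast
  have "distance w n s u \<le> c + c'"
    using c(1) c'(1) by (intro distance_le move_sequence_trans)
  also have "\<dots> \<le> (distance w n s t + ennreal (e / 2)) + (distance w n t u + ennreal (e / 2))"
    using c(2) c'(2) by (intro add_mono) auto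
  also have "\<dots> = distance w n s t + distance w n t u + (ennreal (e / 2) + ennreal (e / 2))"
    by (simp add: ac_simps)
  also have "ennreal (e / 2) + ennreal (e / 2) = ennreal e"
    using e by (simp flip: ennreal_plus)
  finally show "distance w n s u \<le> distance w n s t + distance w n t u + ennreal e" .
qed

lemma allowed_moveI:
  assumes "s \<in> states n" "m < n" "{s (Suc m), j, k} = UNIV"
    and "\<And>l. l \<in> {1..m} \<Longrightarrow> s l \<noteq> s (Suc m) \<and> s l \<noteq> j" and "w m k < \<infinity>"
  shows "allowed_move w n s (w m k) (s(Suc m := j))"
  unfolding allowed_move_def using assms by blast

section \<open>Adding a largest disc\<close>

lemma perfect_in_states: "perfect n i \<in> states n"
  by (auto simp: perfect_def states_def)

lemma perfect_Suc: "perfect (Suc n) i = (perfect n i)(Suc n := i)"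
  by (auto simp: perfect_def restrict_def fun_eq_iff)

lemma restrict_perfect: "restrict (perfect n i) {1..n} = perfect n i"
  by (simp add: perfect_def)

lemma state_upd_in_states: "s \<in> states n \<Longrightarrow> s(Suc n := p) \<in> states (Suc n)"
  by (auto simp: states_def PiE_iff extensional_def)

lemma allowed_move_lift:
  assumes "allowed_move w n s c t"
  shows "allowed_move w (Suc n) (s(Suc n := p)) c (t(Suc n := p))"
proof -
  from assms obtain m i j k where s: "s \<in> states n" and m: "m < n" and ijk: "{i, j, k} = UNIV"
    and i: "s (Suc m) = i" and l: "\<forall>l\<in>{1..m}. s l \<noteq> i \<and> s l \<noteq> j"
    and t: "t = s(Suc m := j)" and c: "c = w m k" "c < \<infinity>"
    unfolding allowed_move_def by blast
  let ?s = "s(Suc n := p)" and ?t = "t(Suc n := p)"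
  have "?s (Suc m) = i" "\<forall>l\<in>{1..m}. ?s l \<noteq> i \<and> ?s l \<noteq> j" "?t = ?s(Suc m := j)"
    using i l m by (auto simp: t fun_upd_twist)
  then show ?thesis
    unfolding allowed_move_def using state_upd_in_states[OF s] m ijk c less_SucI[OF m] by blast
qed

lemma move_sequence_lift:
  assumes "move_sequence w n s c t"
  shows "move_sequence w (Suc n) (s(Suc n := p)) c (t(Suc n := p))"
  using assms
  by induction (blast intro: move_sequence.intros allowed_move_lift state_upd_in_states)+

lemma distance_lift_le:
  "distance w (Suc n) (s(Suc n := p)) (t(Suc n := p)) \<le> distance w n s t"
  unfolding distance_def[of w n] using distance_le move_sequence_lift
  by (intro Inf_greatest) blast

lemma distance_largest_disc_le:
  assumes ijk: "{i, j, k} = UNIV"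
  shows "distance w (Suc n) ((perfect n k)(Suc n := i)) ((perfect n k)(Suc n := j)) \<le> w n k"
proof (cases "w n k < \<infinity>")
  case True
  have "card {i, j, k} = 3" using ijk by simp
  then have "k \<noteq> i" "k \<noteq> j" by (auto simp: card_insert_if split: if_splits)
  then have "allowed_move w (Suc n) ((perfect n k)(Suc n := i)) (w n k)
      ((perfect n k)(Suc n := i, Suc n := j))"
    using True ijk
    by (intro allowed_moveI state_upd_in_states perfect_in_states) (auto simp: perfect_def)
  then have "allowed_move w (Suc n) ((perfect n k)(Suc n := i)) (w n k) ((perfect n k)(Suc n := j))"
    by (simp only: fun_upd_upd)
  then show ?thesis by (rule distance_le_move)
next
  case False
  then show ?thesis by (simp add: not_less top_unique)
qed

text \<open>
  The third peg is the only place for the smaller discs when the largest one moves; this is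
  the rule of the game that forces intermediate perfect states.
\<close>

lemma allowed_move_Suc_cases:
  assumes "allowed_move w (Suc n) s c t"
  obtains (smaller) "t (Suc n) = s (Suc n)"
      "allowed_move w n (restrict s {1..n}) c (restrict t {1..n})"
    | (largest) k where "{s (Suc n), t (Suc n), k} = UNIV" "c = w n k" "c < \<infinity>"
      "restrict s {1..n} = perfect n k" "restrict t {1..n} = perfect n k"
proof -
  from assms obtain m i j k where s: "s \<in> states (Suc n)" and m: "m < Suc n"
    and ijk: "{i, j, k} = UNIV"
    and i: "s (Suc m) = i" and l: "\<forall>l\<in>{1..m}. s l \<noteq> i \<and> s l \<noteq> j"
    and t: "t = s(Suc m := j)" and c: "c = w m k" "c < \<infinity>"
    unfolding allowed_move_def by blast
  show thesis
  proof (cases "m = n")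
    case True
    have "s l = k" if "l \<in> {1..n}" for l
      using l that ijk True by blast
    then have "restrict s {1..n} = perfect n k" "restrict t {1..n} = perfect n k"
      by (auto simp: perfect_def t True fun_eq_iff)
    then show thesis
      using largest[of k] True ijk i t c by simp
  next
    case False
    then have m: "m < n" using m by simp
    have "restrict s {1..n} \<in> states n" by (auto simp: states_def)
    moreover have "restrict s {1..n} (Suc m) = i" using i m by simp
    moreover have "\<forall>l\<in>{1..m}. restrict s {1..n} l \<noteq> i \<and> restrict s {1..n} l \<noteq> j"
      using l m by simp
    moreover have "restrict t {1..n} = (restrict s {1..n})(Suc m := j)"
      using m by (auto simp: t fun_eq_iff)
    ultimately have "allowed_move w n (restrict s {1..n}) c (restrict t {1..n})"
      unfolding allowed_move_def using m ijk c by blast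
    then show thesis using smaller m t by simp
  qed
qed

section \<open>Upper bounds\<close>

lemma distance_end_hub_le:
  assumes "{a, h, b} = (UNIV :: peg set)"
  shows "distance w (Suc n) (perfect (Suc n) a) ((perfect n x)(Suc n := h))
    \<le> distance w n (perfect n a) (perfect n b) + w n b + distance w n (perfect n b) (perfect n x)"
proof -
  let ?d = "distance w (Suc n)" and ?s = "\<lambda>i p. (perfect n i)(Suc n := p)"
  have "?d (?s a a) (?s x h) \<le> ?d (?s a a) (?s b a) + ?d (?s b a) (?s b h) + ?d (?s b h) (?s x h)"
    by (meson add_right_mono distance_triangle order_trans)
  also have "\<dots> \<le> distance w n (perfect n a) (perfect n b) + w n b
      + distance w n (perfect n b) (perfect n x)"
    by (intro add_mono distance_lift_le distance_largest_disc_le assms)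
  finally show ?thesis by (simp add: perfect_Suc)
qed

lemma distance_end_end_le:
  assumes "{a, h, b} = (UNIV :: peg set)"
  shows "distance w (Suc n) (perfect (Suc n) a) (perfect (Suc n) b)
    \<le> distance w n (perfect n a) (perfect n b) + w n b
      + distance w n (perfect n b) (perfect n a) + w n a
      + distance w n (perfect n a) (perfect n b)"
proof -
  let ?d = "distance w (Suc n)" and ?s = "\<lambda>i p. (perfect n i)(Suc n := p)"
  have hba: "{h, b, a} = UNIV" using assms by (simp add: insert_commute)
  have "?d (perfect (Suc n) a) (?s b b)
      \<le> ?d (perfect (Suc n) a) (?s a h) + ?d (?s a h) (?s a b) + ?d (?s a b) (?s b b)"
    by (meson add_right_mono distance_triangle order_trans)
  also have "\<dots> \<le> (distance w n (perfect n a) (perfect n b) + w n b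
      + distance w n (perfect n b) (perfect n a)) + w n a
      + distance w n (perfect n a) (perfect n b)"
    by (intro add_mono distance_lift_le distance_largest_disc_le distance_end_hub_le assms hba)
  finally show ?thesis by (simp add: perfect_Suc)
qed

section \<open>Lower bounds\<close>

text \<open>
  The cost of the direct walk of the largest disc from \<open>a\<close> to its peg in \<open>u\<close>, with the smaller
  discs ending in the configuration that they have in \<open>u\<close>.
\<close>

definition potential ::
    "(nat \<Rightarrow> peg \<Rightarrow> ennreal) \<Rightarrow> nat \<Rightarrow> peg \<Rightarrow> peg \<Rightarrow> peg \<Rightarrow> state \<Rightarrow> ennreal" where
  "potential w n a h b u =
    (let d = distance w n; v = restrict u {1..n} in
     if u (Suc n) = a then d (perfect n a) v
     else if u (Suc n) = h then d (perfect n a) (perfect n b) + w n b + d (perfect n b) v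
     else d (perfect n a) (perfect n b) + w n b + d (perfect n b) (perfect n a) + w n a
       + d (perfect n a) v)"

text \<open>
  A move of a smaller disc affects only the last summand, which the triangle inequality controls.
  When the largest disc moves, the smaller discs are in the very perfect state in which the direct
  walk makes this step. Hence a step away from \<open>a\<close> adds the cost of the move and a vanishing
  last summand, and a step back towards \<open>a\<close> leaves an initial part of the former sum.
\<close>

lemma potential_move_le:
  assumes ahb: "{a, h, b} = (UNIV :: peg set)" and forbidden: "w n h = \<infinity>"
    and move: "allowed_move w (Suc n) s c t"
  shows "potential w n a h b t \<le> potential w n a h b s + c"
  using move
proof (cases rule: allowed_move_Suc_cases)
  case smaller
  have "distance w n x (restrict t {1..n}) \<le> distance w n x (restrict s {1..n}) + c" for x
    using distance_triangle distance_le_move[OF smaller(2)] by (meson add_left_mono order_trans)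
  then show ?thesis
    using smaller(1) by (auto simp: potential_def Let_def add.assoc intro!: add_left_mono)
next
  case (largest k)
  have "card {a, h, b} = 3" using ahb by simp
  then have ne: "a \<noteq> h" "h \<noteq> b" "a \<noteq> b"
    by (auto simp: card_insert_if split: if_splits)
  have "card {s (Suc n), t (Suc n), k} = 3" using largest(1) by simp
  then have ne': "s (Suc n) \<noteq> t (Suc n)" "s (Suc n) \<noteq> k" "t (Suc n) \<noteq> k"
    by (auto simp: card_insert_if split: if_splits)
  have "k \<noteq> h" using largest forbidden by auto
  moreover have "p = a \<or> p = h \<or> p = b" for p
    using ahb by blast
  ultimately consider "s (Suc n) = a" "t (Suc n) = h" "k = b" | "s (Suc n) = h" "t (Suc n) = a" "k = b"
    | "s (Suc n) = h" "t (Suc n) = b" "k = a" | "s (Suc n) = b" "t (Suc n) = h" "k = a"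
    using ne' by metis
  then show ?thesis
  proof cases
    case 1
    then show ?thesis
      using ne largest by (simp add: potential_def Let_def distance_refl perfect_in_states)
  next
    case 2
    then show ?thesis
      using ne largest by (simp add: potential_def Let_def add.assoc)
  next
    case 3
    then show ?thesis
      using ne largest by (simp add: potential_def Let_def distance_refl perfect_in_states)
  next
    case 4
    then show ?thesis
      using ne largest by (simp add: potential_def Let_def add.assoc)
  qed
qed

lemma potential_le_cost:
  assumes ahb: "{a, h, b} = (UNIV :: peg set)" and forbidden: "w n h = \<infinity>"
    and "move_sequence w (Suc n) s c t"
  shows "potential w n a h b t \<le> potential w n a h b s + c"
  using assms(3)
proof induction
  case (empty s)
  show ?case by simp
next
  case (step s c t c' u)
  have "potential w n a h b u \<le> potential w n a h b t + c'"
    using potential_move_le[of a h b w n] ahb forbidden step.hyps(2) by blast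
  also have "\<dots> \<le> potential w n a h b s + c + c'"
    using step.IH by (rule add_right_mono)
  finally show ?case by (simp add: add.assoc)
qed

lemma potential_le_distance:
  assumes "{a, h, b} = (UNIV :: peg set)" and "w n h = \<infinity>"
  shows "potential w n a h b t \<le> distance w (Suc n) (perfect (Suc n) a) t"
proof -
  have "potential w n a h b (perfect (Suc n) a) = 0"
    by (simp add: potential_def perfect_Suc restrict_perfect[simplified] distance_refl
        perfect_in_states)
  then show ?thesis
    unfolding distance_def using potential_le_cost[of a h b w n] assms
    by (intro Inf_greatest) fastforce
qed

section \<open>The recursion\<close>

lemma min_cost_Suc_end_hub:
  assumes ahb: "{a, h, b} = (UNIV :: peg set)" and "w n h = \<infinity>"
  shows "min_cost w (Suc n) a h = min_cost w n a b + w n b + min_cost w n b h"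
proof (rule antisym)
  have "card {a, h, b} = 3" using ahb by simp
  then have "a \<noteq> h" by (auto simp: card_insert_if split: if_splits)
  then show "min_cost w n a b + w n b + min_cost w n b h \<le> min_cost w (Suc n) a h"
    using potential_le_distance[of a h b w n "perfect (Suc n) h"] assms
    by (simp add: min_cost_eq_distance potential_def Let_def perfect_Suc
        restrict_perfect[simplified])
  show "min_cost w (Suc n) a h \<le> min_cost w n a b + w n b + min_cost w n b h"
    using distance_end_hub_le[OF ahb, of w n h] by (simp add: min_cost_eq_distance perfect_Suc)
qed

lemma min_cost_Suc_end_end:
  assumes ahb: "{a, h, b} = (UNIV :: peg set)" and "w n h = \<infinity>"
  shows "min_cost w (Suc n) a b = 3 * min_cost w n a b + w n a + w n b"
proof -
  have "card {a, h, b} = 3" using ahb by simp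
  then have ne: "b \<noteq> h" "b \<noteq> a" by (auto simp: card_insert_if split: if_splits)
  have "min_cost w (Suc n) a b
      = min_cost w n a b + w n b + min_cost w n b a + w n a + min_cost w n a b"
  proof (rule antisym)
    show "min_cost w n a b + w n b + min_cost w n b a + w n a + min_cost w n a b
        \<le> min_cost w (Suc n) a b"
      using ne potential_le_distance[of a h b w n "perfect (Suc n) b"] assms
      by (simp add: min_cost_eq_distance potential_def Let_def perfect_Suc
        restrict_perfect[simplified])
    show "min_cost w (Suc n) a b
        \<le> min_cost w n a b + w n b + min_cost w n b a + w n a + min_cost w n a b"
      using distance_end_end_le[OF ahb, of w n] by (simp add: min_cost_eq_distance)
  qed
  also have "\<dots> = (1 + 1 + 1) * min_cost w n a b + w n a + w n b"
    unfolding min_cost_sym[of w n b a] distrib_right mult_1 by (simp only: ac_simps)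
  finally show ?thesis by simp
qed

text \<open>
  The middle component joins the two ends. The outer components join an end with the hub, where the
  roles of the two ends are exchanged.
\<close>

theorem proposition13:
  fixes w :: "nat \<Rightarrow> peg \<Rightarrow> ennreal"
  assumes "\<forall>n. w n 0 < \<infinity>" and "\<forall>n. w n 2 < \<infinity>"
    and "\<forall>n. w n 1 = \<infinity>"
  shows "\<forall>n. cost_vector w (n + 1) =
    vector [vector [0, 1, 1],
            vector [0, 3, 0],
            vector [1, 1, 0]] *v cost_vector w n
    + vector [w n 0, w n 0 + w n 2, w n 2]"
proof
  fix n
  have pegs: "{0, 1, 2} = (UNIV :: peg set)" "{2, 1, 0} = (UNIV :: peg set)"
    using UNIV_3 by auto
  have cost: "hanoi_cost w m 0 = min_cost w m 2 1" "hanoi_cost w m 1 = min_cost w m 0 2"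
    "hanoi_cost w m 2 = min_cost w m 0 1" for m
    using pegs by (auto intro!: hanoi_cost_eq simp: insert_commute)
  have "hanoi_cost w (Suc n) 0 = hanoi_cost w n 1 + hanoi_cost w n 2 + w n 0"
    using min_cost_Suc_end_hub[OF pegs(2), of w n] assms(3)
    by (simp add: cost min_cost_sym[of w n 2 0] ac_simps)
  moreover have "hanoi_cost w (Suc n) 1 = 3 * hanoi_cost w n 1 + (w n 0 + w n 2)"
    using min_cost_Suc_end_end[OF pegs(1), of w n] assms(3) by (simp add: cost add.assoc)
  moreover have "hanoi_cost w (Suc n) 2 = hanoi_cost w n 0 + hanoi_cost w n 1 + w n 2"
    using min_cost_Suc_end_hub[OF pegs(1), of w n] assms(3) by (simp add: cost ac_simps)
  ultimately show "cost_vector w (n + 1) =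
    vector [vector [0, 1, 1],
            vector [0, 3, 0],
            vector [1, 1, 0]] *v cost_vector w n
    + vector [w n 0, w n 0 + w n 2, w n 2]"
    by (simp add: vec_eq_iff forall_3 cost_vector_def matrix_vector_mult_def sum_3)
qed

end
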